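(* Fix an integer $r\geq 2$ and $\varepsilon>0$. There is a number $C(\varepsilon,r)$ such that for all sufficiently large $t$ and every integer $n>t^{C(\varepsilon,r)}$ there exist an $r$-uniform hypergraph $G$ and a $t$-thick partition $\mathcal P=\{V_1,\dots,V_n\}$ of $V(G)$ such that for each $i\in\{1,\dots,n\}$ at most $\left(\frac{(r-1)^{r-1}}{r^r}+\varepsilon\right)t^r$ edges of $G$ intersect $V_i$ (all edges of $G$ being stretched), but $\mathcal P$ has no independent transversal in $G$.
   Context: An $r$-uniform hypergraph has all edges of size $r$. A partition $\mathcal P$ of $V(G)$ into blocks is $t$-thick if every block has at least $t$ vertices. An edge is stretched (with respect to $\mathcal P$) if its vertices lie in pairwise distinct blocks. An independent transversal of $\mathcal P$ in $G$ is a set of vertices meeting each block in exactly one vertex and containing no edge of $G$. *)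

theory Defs
  imports Complex_Main "HOL-Library.Disjoint_Sets"
begin

text \<open>A hypergraph is given by its vertex set and its edge set, both finite. Edges form a set,
  so there are no repeated edges.\<close>

definition uniform_hypergraph :: "nat \<Rightarrow> 'a set \<Rightarrow> 'a set set \<Rightarrow> bool" where
  "uniform_hypergraph r V E \<longleftrightarrow> finite V \<and> (\<forall>e\<in>E. e \<subseteq> V \<and> card e = r)"

definition thick :: "nat \<Rightarrow> 'a set set \<Rightarrow> bool" where
  "thick t P \<longleftrightarrow> (\<forall>B\<in>P. t \<le> card B)"

definition stretched :: "'a set set \<Rightarrow> 'a set \<Rightarrow> bool" where
  "stretched P e \<longleftrightarrow> (\<forall>u\<in>e. \<forall>v\<in>e. u \<noteq> v \<longrightarrow> \<not> (\<exists>B\<in>P. u \<in> B \<and> v \<in> B))"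

definition independent_transversal :: "'a set \<Rightarrow> 'a set set \<Rightarrow> 'a set set \<Rightarrow> 'a set \<Rightarrow> bool" where
  "independent_transversal V E P T \<longleftrightarrow>
     T \<subseteq> V \<and> (\<forall>B\<in>P. card (T \<inter> B) = 1) \<and> (\<forall>e\<in>E. \<not> e \<subseteq> T)"

end

theory Submission
  imports Defs "HOL-Library.Countable" "HOL-Library.FuncSet"
begin

text \<open>The blocks are the nodes of a rooted tree of constant depth \<open>K\<close>, in which a node has \<open>r - 1\<close>
  children for each of its vertices. Call the number of levels below a node its height. At height
  \<open>k\<close> the first \<open>k d\<close> vertices of a block will be unusable in every independent transversal, where
  \<open>d\<close> is about \<open>\<epsilon> t / 2\<close>: such a vertex is joined by edges to all choices of one usable vertex in
  each of the \<open>r - 1\<close> child blocks belonging to it. With \<open>x\<close> usable vertices in each child this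
  costs about \<open>(t - x + d) x^(r - 1)\<close> edges at the block itself, and AM-GM bounds
  \<open>(t - x) x^(r - 1)\<close> by \<open>(r - 1)^(r - 1) / r^r t^r\<close>. The edges towards the parent number at most
  \<open>t^(r - 1)\<close>. Once \<open>K d \<ge> t\<close>, the root has no usable vertex.\<close>

section \<open>Vertices, blocks and edges over node addresses\<close>

text \<open>The injection \<open>to_nat\<close> packs an address and an index into a natural number,
  since the theorem asks for vertices of type \<open>nat\<close>.\<close>

definition vtx :: "(nat \<times> nat) list \<Rightarrow> nat \<Rightarrow> nat" where
  "vtx p j = to_nat (p, j)"

lemma vtx_eq_iff [simp]: "vtx p j = vtx q k \<longleftrightarrow> p = q \<and> j = k"
  by (simp add: vtx_def)

definition block :: "nat \<Rightarrow> (nat \<times> nat) list \<Rightarrow> nat set" where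
  "block t p = vtx p ` {..<t}"

lemma vtx_in_block_iff [simp]: "vtx p j \<in> block t q \<longleftrightarrow> p = q \<and> j < t"
  by (auto simp: block_def)

lemma block_memE: "v \<in> block t p \<Longrightarrow> (\<And>j. j < t \<Longrightarrow> v = vtx p j \<Longrightarrow> thesis) \<Longrightarrow> thesis"
  by (auto simp: block_def)

lemma finite_block [simp]: "finite (block t p)"
  by (simp add: block_def)

lemma card_block [simp]: "card (block t p) = t"
  by (simp add: block_def card_image inj_on_def)

lemma block_eq_iff: "t > 0 \<Longrightarrow> block t p = block t q \<longleftrightarrow> p = q"
  by (metis vtx_in_block_iff)

text \<open>Throughout, \<open>s = r - 1\<close>. The children of the node \<open>p\<close> belonging to its vertex \<open>j\<close> are
  \<open>p @ [(j, i)]\<close> for \<open>i < s\<close>.\<close>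

definition hedge :: "nat \<Rightarrow> (nat \<times> nat) list \<Rightarrow> nat \<Rightarrow> (nat \<Rightarrow> nat) \<Rightarrow> nat set" where
  "hedge s p j f = insert (vtx p j) ((\<lambda>i. vtx (p @ [(j, i)]) (f i)) ` {..<s})"

lemma card_hedge: "card (hedge s p j f) = Suc s"
  unfolding hedge_def by (subst card_insert_disjoint) (auto simp: card_image inj_on_def)

lemma hedge_same_block:
  "\<lbrakk>u \<in> hedge s p j f; v \<in> hedge s p j f; u \<in> block t q; v \<in> block t q\<rbrakk> \<Longrightarrow> u = v"
  by (auto simp: hedge_def)

text \<open>An edge lives on one node and some of its children, and the last entry of a child's
  address records the parent's vertex \<open>j\<close>. So the edges at a block issue from its own
  node or from one fixed vertex of its parent.\<close>

lemma hedge_meets_block: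
  assumes "hedge s p j f \<inter> block t q \<noteq> {}"
  shows "p = q \<or> p = butlast q \<and> j = fst (last q)"
  using assms by (auto simp: hedge_def)

section \<open>The tree and its hypergraph\<close>

definition tree :: "nat \<Rightarrow> nat \<Rightarrow> nat \<Rightarrow> (nat \<times> nat) list set" where
  "tree t s K = {p. set p \<subseteq> {..<t} \<times> {..<s} \<and> length p \<le> K}"

lemma finite_tree: "finite (tree t s K)"
  by (simp add: tree_def finite_lists_length_le)

text \<open>There are \<open>Suc K\<close> levels, none with more than \<open>t ^ (2 * K)\<close>
  nodes. As \<open>K\<close> will depend on \<epsilon> alone, this yields the exponent
  \<open>C\<close>.\<close>

lemma card_tree_le:
  assumes "0 < s" "s \<le> t" "Suc K \<le> t"
  shows "card (tree t s K) \<le> t ^ (2 * K + 1)"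
proof -
  have "card (tree t s K) = (\<Sum>i\<le>K. (t * s) ^ i)"
    by (simp add: tree_def card_lists_length_le)
  also have "\<dots> \<le> (\<Sum>i\<le>K. (t * t) ^ K)"
  proof (rule sum_mono)
    fix i assume "i \<in> {..K}"
    then have "(t * s) ^ i \<le> (t * s) ^ K"
      using assms by (intro power_increasing) auto
    also have "\<dots> \<le> (t * t) ^ K"
      using assms by (intro power_mono) auto
    finally show "(t * s) ^ i \<le> (t * t) ^ K" .
  qed
  also have "\<dots> = Suc K * (t * t) ^ K" by simp
  also have "\<dots> \<le> t * (t * t) ^ K" using assms by (intro mult_right_mono) auto
  also have "\<dots> = t ^ (2 * K + 1)" by (simp add: power_mult power2_eq_square)
  finally show ?thesis .
qed

definition usable :: "nat \<Rightarrow> nat \<Rightarrow> nat \<Rightarrow> nat \<Rightarrow> (nat \<Rightarrow> nat) set" where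
  "usable t s d k = {..<s} \<rightarrow>\<^sub>E {k * d..<t}"

lemma finite_usable: "finite (usable t s d k)"
  by (simp add: usable_def finite_PiE)

lemma card_usable: "card (usable t s d k) = (t - k * d) ^ s"
  by (simp add: usable_def card_PiE)

text \<open>Here \<open>K - length p\<close> is the height of \<open>p\<close>, and its children are
  one lower. The two bounds on \<open>j\<close> single out the unusable vertices.\<close>

definition edges :: "nat \<Rightarrow> nat \<Rightarrow> nat \<Rightarrow> nat \<Rightarrow> nat set set" where
  "edges t s d K = {hedge s p j f | p j f. p \<in> tree t s K \<and> length p < K \<and>
     j < t \<and> j < (K - length p) * d \<and> f \<in> usable t s d (K - length p - 1)}"

lemma edgesE:
  assumes "e \<in> edges t s d K"
  obtains p j f where "e = hedge s p j f" "p \<in> tree t s K" "length p < K" "j < t"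
    "j < (K - length p) * d" "f \<in> usable t s d (K - length p - 1)"
  using assms by (auto simp: edges_def)

lemma tree_child:
  assumes "p \<in> tree t s K" "length p < K" "j < t" "i < s"
  shows "p @ [(j, i)] \<in> tree t s K"
  using assms by (auto simp: tree_def)

lemma edges_subset:
  assumes "e \<in> edges t s d K"
  shows "e \<subseteq> (\<Union>p\<in>tree t s K. block t p)"
proof -
  obtain p j f where e: "e = hedge s p j f" "p \<in> tree t s K" "length p < K" "j < t"
    "f \<in> usable t s d (K - length p - 1)"
    using assms by (rule edgesE)
  have "f i < t" if "i < s" for i
    using e(5) that by (auto simp: usable_def PiE_iff)
  then show ?thesis
    using e tree_child[OF e(2-4)] unfolding hedge_def by force
qed

lemma no_independent_transversal:
  assumes I: "tree t s K \<subseteq> I" and Kd: "t \<le> K * d"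
  shows "\<not> independent_transversal V (edges t s d K) (block t ` I) T"
proof
  assume T: "independent_transversal V (edges t s d K) (block t ` I) T"
  have one: "\<exists>j<t. vtx p j \<in> T" if "p \<in> tree t s K" for p
  proof -
    have "card (T \<inter> block t p) = 1"
      using T I that by (auto simp: independent_transversal_def)
    then obtain v where "T \<inter> block t p = {v}" by (auto simp: card_1_singleton_iff)
    then have "v \<in> T" "v \<in> block t p" by auto
    then show ?thesis by (auto elim: block_memE)
  qed
  \<comment> \<open>Induction on the height, from the leaves up: if \<open>T\<close> contained an
    unusable vertex, its choices in the corresponding child blocks would be usable by induction and
    would complete an edge inside \<open>T\<close>.\<close>
  have unusable: "vtx p j \<notin> T"
    if "p \<in> tree t s K" "length p + k = K" "j < t" "j < k * d" for p j k
    using that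
  proof (induction k arbitrary: p j)
    case 0
    then show ?case by simp
  next
    case (Suc k)
    have child: "p @ [(j, i)] \<in> tree t s K" if "i < s" for i
      using that Suc.prems by (intro tree_child) auto
    have "\<exists>m\<in>{k * d..<t}. vtx (p @ [(j, i)]) m \<in> T" if i: "i < s" for i
    proof -
      obtain m where "m < t" "vtx (p @ [(j, i)]) m \<in> T"
        using one[OF child[OF i]] by auto
      moreover from this have "\<not> m < k * d"
        using Suc.IH[OF child[OF i]] Suc.prems by auto
      ultimately show ?thesis by auto
    qed
    then obtain g where g: "\<And>i. i < s \<Longrightarrow> g i \<in> {k * d..<t} \<and> vtx (p @ [(j, i)]) (g i) \<in> T"
      by metis
    have *: "K - length p = Suc k" "length p < K" using Suc.prems by auto
    \<comment> \<open>\<open>hedge\<close> reads \<open>g\<close> only below \<open>s\<close>, so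
      making it extensional does not change the edge.\<close>
    have "restrict g {..<s} \<in> usable t s d k"
      using g by (auto simp: usable_def)
    then have "hedge s p j (restrict g {..<s}) \<in> edges t s d K"
      unfolding edges_def using Suc.prems * by fastforce
    then have "\<not> hedge s p j (restrict g {..<s}) \<subseteq> T"
      using T by (auto simp: independent_transversal_def)
    then show ?case using g by (auto simp: hedge_def)
  qed
  have "[] \<in> tree t s K" by (simp add: tree_def)
  with one unusable[of "[]" K] Kd show False by fastforce
qed

section \<open>Counting the edges at a block\<close>

lemma power_mult_diff_le:
  fixes x t :: real
  assumes "0 < s" "0 \<le> x" "0 \<le> t"
  shows "(t - x) * x ^ s \<le> real s ^ s / real (Suc s) ^ Suc s * t ^ Suc s"
proof (cases "x = 0")
  case True
  then have "(t - x) * x ^ s = 0" using assms by simp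
  moreover have "0 \<le> real s ^ s / real (Suc s) ^ Suc s * t ^ Suc s" using assms by simp
  ultimately show ?thesis by linarith
next
  case False
  \<comment> \<open>\<open>u\<close> is the ratio of the maximiser \<open>s t / (s + 1)\<close> to
    \<open>x\<close>. In terms of \<open>u\<close> the claim is the tangent bound for
    \<open>u ^ Suc s\<close> at 1, which is Bernoulli's inequality.\<close>
  define u where "u = t * s / (Suc s * x)"
  have t: "t = Suc s * x * u / s" using False assms by (simp add: u_def del: of_nat_Suc)
  have "u \<ge> 0" using assms by (simp add: u_def del: of_nat_Suc)
  then have "1 + real (Suc s) * (u - 1) \<le> (1 + (u - 1)) ^ Suc s"
    by (intro Bernoulli_inequality) simp
  then have b: "Suc s * u - s \<le> u ^ Suc s" by (simp add: algebra_simps)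
  have "(t - x) * x ^ s = x ^ Suc s / s * (Suc s * u - s)"
    using assms by (simp add: t field_simps del: of_nat_Suc)
  also have "\<dots> \<le> x ^ Suc s / s * u ^ Suc s"
    using b assms by (intro mult_left_mono) (auto simp del: of_nat_Suc)
  also have "\<dots> = real s ^ s / real (Suc s) ^ Suc s * t ^ Suc s"
    using assms by (simp add: t power_mult_distrib power_divide del: of_nat_Suc)
  finally show ?thesis .
qed

text \<open>The first summand counts edges going down from \<open>q\<close>, the second those coming
  from its parent, where the vertex is fixed and only the choice varies. From depth \<open>K\<close>
  on, truncated subtraction makes the first summand vanish.\<close>

lemma card_edges_meeting_block:
  "card {e \<in> edges t s d K. e \<inter> block t q \<noteq> {}}
    \<le> min t ((K - length q) * d) * (t - (K - length q - 1) * d) ^ s + t ^ s"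
proof -
  let ?A = "{..<min t ((K - length q) * d)} \<times> usable t s d (K - length q - 1)"
  let ?k = "K - length (butlast q) - 1"
  let ?down = "(\<lambda>(j, f). hedge s q j f) ` ?A"
  \<comment> \<open>For the root, \<open>last []\<close> is unspecified; \<open>?up\<close> then
    merely enlarges the covering family.\<close>
  let ?up = "hedge s (butlast q) (fst (last q)) ` usable t s d ?k"
  have "{e \<in> edges t s d K. e \<inter> block t q \<noteq> {}} \<subseteq> ?down \<union> ?up"
  proof
    fix e assume "e \<in> {e \<in> edges t s d K. e \<inter> block t q \<noteq> {}}"
    then have e: "e \<in> edges t s d K" "e \<inter> block t q \<noteq> {}" by auto
    obtain p j f where *: "e = hedge s p j f" "j < t" "j < (K - length p) * d"
      "f \<in> usable t s d (K - length p - 1)"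
      using e(1) by (rule edgesE)
    from hedge_meets_block[OF e(2)[unfolded *(1)]] show "e \<in> ?down \<union> ?up"
    proof
      assume "p = q"
      then have "(j, f) \<in> ?A" using * by simp
      then have "e \<in> ?down" using \<open>p = q\<close> *(1) by (intro image_eqI[where x = "(j, f)"]) auto
      then show ?thesis ..
    next
      assume "p = butlast q \<and> j = fst (last q)"
      then have "e \<in> ?up" using * by blast
      then show ?thesis ..
    qed
  qed
  then have "card {e \<in> edges t s d K. e \<inter> block t q \<noteq> {}} \<le> card (?down \<union> ?up)"
    by (intro card_mono) (auto intro: finite_usable)
  also have "\<dots> \<le> card ?down + card ?up" by (rule card_Un_le)
  also have "\<dots> \<le> card ?A + card (usable t s d ?k)"
    by (intro add_mono card_image_le) (auto intro: finite_usable)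
  also have "\<dots> \<le> min t ((K - length q) * d) * (t - (K - length q - 1) * d) ^ s + t ^ s"
    unfolding card_cartesian_product card_usable by (intro add_mono power_mono) auto
  finally show ?thesis .
qed

lemma card_edges_meeting_block_real:
  assumes s: "0 < s" and d: "real d + 1 \<le> \<epsilon> * t"
  shows "real (card {e \<in> edges t s d K. e \<inter> block t q \<noteq> {}})
    \<le> (real s ^ s / real (Suc s) ^ Suc s + \<epsilon>) * real t ^ Suc s"
proof -
  define k where "k = K - length q"
  define x where "x = t - (k - 1) * d"
  \<comment> \<open>A block has at most \<open>d\<close> more unusable vertices than the
    \<open>t - x\<close> of a child; at height 0 the minimum is 0.\<close>
  have m: "min t (k * d) \<le> t - x + d"
  proof (cases k)
    case (Suc k')
    then show ?thesis by (simp add: x_def)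
  qed simp
  have "x \<le> t" by (simp add: x_def)
  have "card {e \<in> edges t s d K. e \<inter> block t q \<noteq> {}} \<le> min t (k * d) * x ^ s + t ^ s"
    using card_edges_meeting_block by (simp add: k_def x_def)
  also have "\<dots> \<le> (t - x + d) * x ^ s + t ^ s"
    using m by (intro add_right_mono mult_right_mono) auto
  also have "\<dots> \<le> (t - x) * x ^ s + d * t ^ s + t ^ s"
    using \<open>x \<le> t\<close> unfolding add_mult_distrib
    by (intro add_mono mult_left_mono power_mono) auto
  finally have "real (card {e \<in> edges t s d K. e \<inter> block t q \<noteq> {}})
      \<le> real ((t - x) * x ^ s + d * t ^ s + t ^ s)"
    by (simp only: of_nat_le_iff)
  \<comment> \<open>The main term is left to AM-GM; the \<open>d\<close> extra vertices and the
    edges to the parent form the error absorbed by \<epsilon>.\<close>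
  also have "\<dots> = (real t - real x) * real x ^ s + (real d + 1) * real t ^ s"
    using \<open>x \<le> t\<close> by (simp add: of_nat_diff distrib_right)
  also have "\<dots> \<le> real s ^ s / real (Suc s) ^ Suc s * real t ^ Suc s + (\<epsilon> * t) * real t ^ s"
    using s d by (intro add_mono power_mult_diff_le mult_right_mono) auto
  also have "\<dots> = (real s ^ s / real (Suc s) ^ Suc s + \<epsilon>) * real t ^ Suc s"
    by (simp add: distrib_right)
  finally show ?thesis .
qed

section \<open>Padding and choice of parameters\<close>

lemma finite_superset_card:
  assumes "finite A" "infinite (UNIV :: 'a set)" "card A \<le> n"
  obtains B :: "'a set" where "A \<subseteq> B" "finite B" "card B = n"
proof -
  have "infinite (- A)" using assms by (simp add: Compl_eq_Diff_UNIV)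
  then obtain D where D: "finite D" "card D = n - card A" "D \<subseteq> - A"
    using infinite_arbitrarily_large by blast
  then have "card (A \<union> D) = n"
    using assms by (subst card_Un_disjoint) auto
  with D assms show thesis by (intro that[of "A \<union> D"]) auto
qed

text \<open>Addresses outside the tree pad the partition to exactly \<open>n\<close> blocks. All
  edges lie over the tree, so the padding blocks meet none.\<close>

lemma tree_construction:
  assumes s: "0 < s" and t: "0 < t" and d: "real d + 1 \<le> \<epsilon> * t" and Kd: "t \<le> K * d"
    and n: "card (tree t s K) \<le> n"
  shows "\<exists>(V :: nat set) E P.
       uniform_hypergraph (Suc s) V E \<and> partition_on V P \<and> card P = n \<and> thick t P \<and>
       (\<forall>e\<in>E. stretched P e) \<and>
       (\<forall>B\<in>P. real (card {e \<in> E. e \<inter> B \<noteq> {}})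
                \<le> (real s ^ s / real (Suc s) ^ Suc s + \<epsilon>) * real t ^ Suc s) \<and>
       \<not> (\<exists>T. independent_transversal V E P T)"
proof -
  obtain I where I: "tree t s K \<subseteq> I" "finite I" "card I = n"
    using finite_superset_card[OF finite_tree infinite_UNIV_listI n] by blast
  let ?P = "block t ` I" and ?E = "edges t s d K"
  have "e \<subseteq> \<Union> ?P \<and> card e = Suc s" if "e \<in> ?E" for e
    using edges_subset[OF that] I that by (auto elim!: edgesE simp: card_hedge)
  then have "uniform_hypergraph (Suc s) (\<Union> ?P) ?E"
    using I by (simp add: uniform_hypergraph_def)
  moreover have "partition_on (\<Union> ?P) ?P"
  proof (rule partition_onI)
    show "{} \<notin> ?P"
      using t by (auto simp: block_def)
    show "disjnt p q" if "p \<in> ?P" "q \<in> ?P" "p \<noteq> q" for p q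
      using that by (auto simp: disjnt_def elim!: block_memE)
  qed simp
  moreover have "card ?P = n"
    using I t by (simp add: card_image inj_on_def block_eq_iff)
  moreover have "thick t ?P" by (simp add: thick_def)
  moreover have "stretched ?P e" if "e \<in> ?E" for e
    using that unfolding stretched_def by (blast elim: edgesE dest: hedge_same_block)
  moreover have "real (card {e \<in> ?E. e \<inter> B \<noteq> {}})
      \<le> (real s ^ s / real (Suc s) ^ Suc s + \<epsilon>) * real t ^ Suc s" if "B \<in> ?P" for B
    using that card_edges_meeting_block_real[OF s d] by blast
  ultimately show ?thesis
    using no_independent_transversal[OF I(1) Kd] by blast
qed

theorem theorem4p2:
  fixes r :: nat and \<epsilon> :: real
  assumes "r \<ge> 2" and "\<epsilon> > 0"
  shows "\<exists>C::real. \<forall>\<^sub>F t in sequentially. \<forall>n::nat. real n > real t powr C \<longrightarrow>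
    (\<exists>(V :: nat set) E P.
       uniform_hypergraph r V E \<and> partition_on V P \<and> card P = n \<and> thick t P \<and>
       (\<forall>e\<in>E. stretched P e) \<and>
       (\<forall>B\<in>P. real (card {e \<in> E. e \<inter> B \<noteq> {}})
                \<le> ((real r - 1) ^ (r - 1) / real r ^ r + \<epsilon>) * real t ^ r) \<and>
       \<not> (\<exists>T. independent_transversal V E P T))"
proof -
  define s where "s = r - 1"
  have s: "0 < s" and r: "r = Suc s" using assms by (auto simp: s_def)
  define K where "K = nat \<lceil>4 / \<epsilon>\<rceil>"
  have "4 / \<epsilon> \<le> real K" by (simp add: K_def real_nat_ceiling_ge)
  then have K: "4 \<le> K * \<epsilon>" using assms by (simp add: field_simps)
  show ?thesis
  proof (intro exI[of _ "real (2 * K + 1)"] eventually_sequentiallyI allI impI)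
    fix t n :: nat
    assume "max (max s (Suc K)) (nat \<lceil>4 / \<epsilon>\<rceil>) \<le> t" and n: "real t powr real (2 * K + 1) < real n"
    then have t: "s \<le> t" "Suc K \<le> t" and "nat \<lceil>4 / \<epsilon>\<rceil> \<le> t" by auto
    then have "4 / \<epsilon> \<le> real t" by linarith
    then have et: "4 \<le> \<epsilon> * t" using assms by (simp add: field_simps)
    \<comment> \<open>Since \<open>\<epsilon> * t\<close> is at least 4, rounding its half down
      keeps \<open>d\<close> at least \<open>\<epsilon> * t / 4\<close>, so the choice of
      \<open>K\<close> gives \<open>t \<le> K * d\<close>, while \<open>d + 1\<close> still fits
      below \<open>\<epsilon> * t\<close>.\<close>
    define d where "d = nat \<lfloor>\<epsilon> * t / 2\<rfloor>"
    have d: "real d \<le> \<epsilon> * t / 2" "\<epsilon> * t / 2 - 1 \<le> real d"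
      using et by (simp_all add: d_def) linarith
    have "real t * 4 \<le> real t * (K * \<epsilon>)" using K by (intro mult_left_mono) auto
    also have "\<dots> = real K * (\<epsilon> * t)" by simp
    also have "\<dots> \<le> real K * (4 * d)" using d et by (intro mult_left_mono) auto
    finally have "real t \<le> real (K * d)" by simp
    then have Kd: "t \<le> K * d" by (simp only: of_nat_le_iff)
    have "real t powr real (2 * K + 1) = real (t ^ (2 * K + 1))"
      using t by (subst powr_realpow) auto
    with n have "t ^ (2 * K + 1) < n" by (simp only: of_nat_less_iff)
    then have "card (tree t s K) \<le> n" using card_tree_le[OF s t] by linarith
    moreover have "real d + 1 \<le> \<epsilon> * t" using d et by linarith
    moreover have "real r - 1 = real s" "r - 1 = s" by (simp_all add: r)
    ultimately show "\<exists>(V :: nat set) E P.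
       uniform_hypergraph r V E \<and> partition_on V P \<and> card P = n \<and> thick t P \<and>
       (\<forall>e\<in>E. stretched P e) \<and>
       (\<forall>B\<in>P. real (card {e \<in> E. e \<inter> B \<noteq> {}})
                \<le> ((real r - 1) ^ (r - 1) / real r ^ r + \<epsilon>) * real t ^ r) \<and>
       \<not> (\<exists>T. independent_transversal V E P T)"
      using tree_construction[OF s _ _ Kd] t by (simp only: r)
  qed
qed

end
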